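(* The polynomial $S_{8,4}(A,B)$ is not cyclically equivalent to a sum of Hermitian squares in $\mathbf{R}\langle A,B\rangle$.
   Context: $\mathbf{R}\langle A,B\rangle$ is the algebra of real polynomials in noncommuting variables $A$ and $B$, endowed with the linear, anti-multiplicative involution $*$ such that $A^*=A$ and $B^*=B$. $S_{8,4}(A,B)$ denotes the sum of all words of length $8$ in $A$ and $B$ having exactly $4$ letters equal to $B$ and $4$ letters equal to $A$. A Hermitian square is an element of the form $f^*f$ with $f\in\mathbf{R}\langle A,B\rangle$; sums are finite. Two elements $f,g\in\mathbf{R}\langle A,B\rangle$ are cyclically equivalent if $f-g$ is a finite sum of commutators $[a,b]=ab-ba$ of elements of $\mathbf{R}\langle A,B\rangle$. *)

theory Defs
  imports Complex_Main "HOL-Library.Poly_Mapping"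
begin

text \<open>
  The words over an alphabet form the free monoid. It is written additively here (the sum of two
  words is their concatenation, zero is the empty word), because the convolution product on
  finitely supported functions \<open>'a \<Rightarrow>\<^sub>0 'b\<close> is defined for additively written monoids of keys.
\<close>

instantiation list :: (type) monoid_add
begin

definition zero_list :: "'a list" where
  "0 = []"

definition plus_list :: "'a list \<Rightarrow> 'a list \<Rightarrow> 'a list" where
  "xs + ys = xs @ ys"

instance
  by standard (simp_all add: zero_list_def plus_list_def)

end

datatype letter = A | B

text \<open>
  The free algebra on two noncommuting letters is the monoid algebra of the free monoid: an element
  assigns a real coefficient to each word, with finite support, and multiplication is convolution.
  The ring structure is the one of \<^theory>\<open>HOL-Library.Poly_Mapping\<close>.
\<close>

type_synonym nc_poly = "letter list \<Rightarrow>\<^sub>0 real"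

definition nc_var :: "letter \<Rightarrow> nc_poly" where
  "nc_var x = Poly_Mapping.single [x] 1"

definition nc_word :: "letter list \<Rightarrow> nc_poly" where
  "nc_word w = prod_list (map nc_var w)"

lemma nc_word_eq_single: "nc_word w = Poly_Mapping.single w 1"
proof (induction w)
  case Nil
  have "Poly_Mapping.single (0 :: letter list) (1 :: real) = 1"
    by (rule single_one)
  then show ?case
    by (simp add: nc_word_def zero_list_def)
next
  case (Cons x w)
  then show ?case
    by (simp add: nc_word_def nc_var_def mult_single plus_list_def)
qed

text \<open>
  The coefficient of a word \<open>w\<close> in \<open>nc_star f\<close> is the coefficient of \<open>rev w\<close> in \<open>f\<close>. The lemmas
  below say that this is the linear anti-multiplicative involution that fixes both letters.
\<close>

definition nc_star :: "nc_poly \<Rightarrow> nc_poly" where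
  "nc_star f = Poly_Mapping.map_key rev f"

lemma nc_star_zero: "nc_star 0 = 0"
  by (simp add: nc_star_def)

lemma nc_star_add: "nc_star (f + g) = nc_star f + nc_star g"
  by (simp add: nc_star_def map_key_plus)

lemma nc_star_single:
  "nc_star (Poly_Mapping.single w c) = Poly_Mapping.single (rev w) c"
  using map_key_single[of rev "rev w" c] by (simp add: nc_star_def)

lemma nc_star_scale:
  "nc_star (Poly_Mapping.map ((*) c) f) = Poly_Mapping.map ((*) c) (nc_star f)"
  by (simp add: nc_star_def map_key_map)

lemma nc_star_var: "nc_star (nc_var x) = nc_var x"
  by (simp add: nc_var_def nc_star_single)

lemma nc_star_star: "nc_star (nc_star f) = f"
  by (rule poly_mapping_eqI) (simp add: nc_star_def map_key.rep_eq)

lemma nc_poly_induct [case_names zero add]: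
  fixes f :: nc_poly
  assumes "P 0"
    and "\<And>f w c. P f \<Longrightarrow> P (f + Poly_Mapping.single w c)"
  shows "P f"
proof (induction f rule: update_induct)
  case const
  then show ?case
    by (rule assms(1))
next
  case (update f w c)
  have "Poly_Mapping.update w c f = f + Poly_Mapping.single w c"
    using update.hyps
    by (intro poly_mapping_eqI)
      (auto simp: lookup_update lookup_add lookup_single when_def in_keys_iff)
  then show ?case
    using assms(2)[OF update.IH] by simp
qed

lemma nc_star_mult: "nc_star (f * g) = nc_star g * nc_star f"
proof (induction f rule: nc_poly_induct)
  case zero
  then show ?case
    by (simp add: nc_star_zero)
next
  case (add f w c)
  have "nc_star (Poly_Mapping.single w c * g) = nc_star g * nc_star (Poly_Mapping.single w c)"
    by (induction g rule: nc_poly_induct)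
      (simp_all add: nc_star_zero nc_star_add nc_star_single distrib_left distrib_right
        mult_single plus_list_def mult.commute)
  with add show ?case
    by (simp add: nc_star_add distrib_left distrib_right)
qed

text \<open>
  \<open>nc_S m k\<close> is the sum of all words of length \<open>m\<close> with exactly \<open>k\<close> letters \<open>B\<close>,
  the other \<open>m - k\<close> letters being \<open>A\<close>.
\<close>

definition nc_S :: "nat \<Rightarrow> nat \<Rightarrow> nc_poly" where
  "nc_S m k = (\<Sum>w \<in> {w. length w = m \<and> count_list w B = k}. nc_word w)"

lemma finite_nc_S_index: "finite {w :: letter list. length w = m \<and> count_list w B = k}"
proof -
  have "(UNIV :: letter set) = {A, B}"
    using letter.exhaust by auto
  then have "finite (UNIV :: letter set)"
    by (metis finite.emptyI finite_insert)
  from finite_lists_length_eq[OF this, of m]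
  have "finite {w :: letter list. length w = m}"
    by simp
  then show ?thesis
    by (rule rev_finite_subset) auto
qed

definition commutator :: "'a::ring \<Rightarrow> 'a \<Rightarrow> 'a" where
  "commutator a b = a * b - b * a"

definition cyclically_equivalent :: "nc_poly \<Rightarrow> nc_poly \<Rightarrow> bool" where
  "cyclically_equivalent f g \<longleftrightarrow>
    (\<exists>ps :: (nc_poly \<times> nc_poly) list. f - g = (\<Sum>(a, b)\<leftarrow>ps. commutator a b))"

definition sum_of_hermitian_squares :: "nc_poly \<Rightarrow> bool" where
  "sum_of_hermitian_squares f \<longleftrightarrow> (\<exists>gs :: nc_poly list. f = (\<Sum>g\<leftarrow>gs. nc_star g * g))"

end

theory Submission
  imports Defs
begin

text \<open>
  The proof separates \<open>nc_S 8 4\<close> from the Hermitian squares by a trace, that is, by a linear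
  functional that vanishes on commutators. Such a functional is given by a function on words that
  is invariant under cyclic rotation, and it takes equal values on cyclically equivalent
  polynomials.

  The trace used is \<open>rotation_sum weight\<close>. It lives on words with four letters \<open>A\<close> and four
  letters \<open>B\<close>, and its value at \<open>nc_S 8 4\<close> is \<open>-8\<close> (\<open>rotation_sum_weight_nc_S\<close>). On the span of
  the six words with two letters of each kind it is nonnegative at every Hermitian square: there
  \<open>g \<mapsto> nc_eval (rotation_sum weight) (nc_star g * g)\<close> is an explicit sum of squares of linear forms
  in the coefficients of \<open>g\<close> (\<open>rotation_sum_weight_quadratic_form\<close>).

  This trace is not nonnegative at all Hermitian squares, because an arbitrary \<open>g\<close> can contribute
  products of a word of bidegree \<open>(a, b)\<close> with one of bidegree \<open>(4 - a, 4 - b)\<close>. It is enough to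
  know that in a sum of Hermitian squares cyclically equivalent to \<open>nc_S 8 4\<close> no word of any of the
  squared polynomials contains a letter more than twice: then both bidegrees have entries at most 2
  and sum \<open>(4, 4)\<close>, so both are \<open>(2, 2)\<close>.

  This bound (\<open>count_le_of_cyclically_equivalent_squares\<close>) is a leading term argument. If \<open>m\<close> is the
  largest number of letters \<open>x\<close> in a word of the squared polynomials, then the parts of degree \<open>2m\<close>
  in \<open>x\<close> of the squares are the squares of the parts of degree \<open>m\<close>. If \<open>m > 2\<close>, these squares add up
  to a polynomial that is cyclically equivalent to zero, so every trace vanishes on their sum. But
  for a longest word \<open>p\<close> among those with \<open>m\<close> letters \<open>x\<close> there is a trace, coming from a pair of
  symmetric matrices, that is nonnegative at all these squares and positive at those of polynomials
  in which \<open>p\<close> occurs. The matrices are the adjacency matrices of a path whose consecutive edges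
  are labelled by the letters of \<open>p\<close>.
\<close>

section \<open>Linear functionals and traces on the free algebra\<close>

definition nc_eval :: "(letter list \<Rightarrow> real) \<Rightarrow> nc_poly \<Rightarrow> real" where
  "nc_eval \<phi> f = (\<Sum>w \<in> Poly_Mapping.keys f. Poly_Mapping.lookup f w * \<phi> w)"

definition tracial :: "(letter list \<Rightarrow> real) \<Rightarrow> bool" where
  "tracial \<phi> \<longleftrightarrow> (\<forall>u v. \<phi> (u @ v) = \<phi> (v @ u))"

lemma nc_eval_superset:
  assumes "finite K" "Poly_Mapping.keys f \<subseteq> K"
  shows "nc_eval \<phi> f = (\<Sum>w \<in> K. Poly_Mapping.lookup f w * \<phi> w)"
  unfolding nc_eval_def
  by (rule sum.mono_neutral_left) (use assms in \<open>auto simp: in_keys_iff\<close>)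

lemma nc_eval_zero [simp]: "nc_eval \<phi> 0 = 0"
  by (simp add: nc_eval_def)

lemma nc_eval_add: "nc_eval \<phi> (f + g) = nc_eval \<phi> f + nc_eval \<phi> g"
proof -
  define K where "K = Poly_Mapping.keys f \<union> Poly_Mapping.keys g"
  have K: "finite K" "Poly_Mapping.keys f \<subseteq> K" "Poly_Mapping.keys g \<subseteq> K"
    "Poly_Mapping.keys (f + g) \<subseteq> K"
    using Poly_Mapping.keys_add[of f g] by (auto simp: K_def)
  show ?thesis
    by (simp add: nc_eval_superset[OF K(1) K(2)] nc_eval_superset[OF K(1) K(3)]
        nc_eval_superset[OF K(1) K(4)] lookup_add distrib_right sum.distrib)
qed

lemma nc_eval_diff: "nc_eval \<phi> (f - g) = nc_eval \<phi> f - nc_eval \<phi> g"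
  using nc_eval_add[of \<phi> "f - g" g] by simp

lemma nc_eval_single: "nc_eval \<phi> (Poly_Mapping.single w c) = c * \<phi> w"
  by (simp add: nc_eval_def)

lemma nc_eval_sum: "nc_eval \<phi> (\<Sum>i\<in>I. f i) = (\<Sum>i\<in>I. nc_eval \<phi> (f i))"
  by (induction I rule: infinite_finite_induct) (simp_all add: nc_eval_add)

lemma nc_eval_sum_list: "nc_eval \<phi> (\<Sum>x\<leftarrow>xs. f x) = (\<Sum>x\<leftarrow>xs. nc_eval \<phi> (f x))"
  by (induction xs) (simp_all add: nc_eval_add)

lemma nc_eval_mult:
  "nc_eval \<phi> (f * g) = nc_eval (\<lambda>u. nc_eval (\<lambda>v. \<phi> (u @ v)) g) f"
proof (induction f rule: nc_poly_induct)
  case zero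
  then show ?case by simp
next
  case (add f u c)
  have "nc_eval \<phi> (Poly_Mapping.single u c * g) = c * nc_eval (\<lambda>v. \<phi> (u @ v)) g"
    by (induction g rule: nc_poly_induct)
      (simp_all add: nc_eval_add nc_eval_single distrib_left mult_single plus_list_def)
  with add show ?case
    by (simp add: nc_eval_add nc_eval_single distrib_right)
qed

lemma nc_eval_star: "nc_eval \<phi> (nc_star f) = nc_eval (\<lambda>w. \<phi> (rev w)) f"
  by (induction f rule: nc_poly_induct)
    (simp_all add: nc_star_zero nc_star_add nc_star_single nc_eval_add nc_eval_single)

lemma nc_eval_hermitian_square:
  assumes "finite K" "Poly_Mapping.keys g \<subseteq> K"
  shows "nc_eval \<phi> (nc_star g * g) =
    (\<Sum>u\<in>K. \<Sum>v\<in>K. Poly_Mapping.lookup g u * Poly_Mapping.lookup g v * \<phi> (rev u @ v))"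
  by (simp add: nc_eval_mult nc_eval_star nc_eval_superset[OF assms] sum_distrib_left mult.assoc)

lemma nc_eval_commutator:
  assumes "tracial \<phi>"
  shows "nc_eval \<phi> (commutator a b) = 0"
proof -
  have "nc_eval \<phi> (a * b) = nc_eval \<phi> (b * a)"
    using assms unfolding nc_eval_mult
    unfolding nc_eval_def[of _ a] nc_eval_def[of _ b] tracial_def sum_distrib_left
    by (subst sum.swap) (simp add: mult.left_commute)
  then show ?thesis
    by (simp add: commutator_def nc_eval_diff)
qed

lemma nc_eval_cyclically_equivalent:
  assumes "tracial \<phi>" "cyclically_equivalent f g"
  shows "nc_eval \<phi> f = nc_eval \<phi> g"
proof -
  obtain ps where "f - g = (\<Sum>(a, b)\<leftarrow>ps. commutator a b)"
    using assms(2) unfolding cyclically_equivalent_def by blast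
  moreover have "nc_eval \<phi> (\<Sum>(a, b)\<leftarrow>ps. commutator a b) = 0"
    by (induction ps) (auto simp: nc_eval_add nc_eval_commutator[OF assms(1)])
  ultimately show ?thesis
    using nc_eval_diff[of \<phi> f g] by simp
qed

section \<open>Walks on a labelled path\<close>

text \<open>
  The path has the vertices \<open>0, \<dots>, length p\<close>, and its edge between \<open>i\<close> and \<open>Suc i\<close> is labelled
  \<open>p ! i\<close>. For each letter \<open>x\<close>, \<open>path_edge p x\<close> is the symmetric adjacency matrix of the edges with
  label \<open>x\<close>. Substituting these two matrices for the letters sends a word \<open>w\<close> to the matrix
  \<open>path_walks p w\<close>, which counts the walks whose edge labels spell \<open>w\<close>. Because the matrices are
  symmetric, the involution becomes transposition, so that Hermitian squares go to positive
  semidefinite matrices.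
\<close>

definition path_edge :: "letter list \<Rightarrow> letter \<Rightarrow> nat \<Rightarrow> nat \<Rightarrow> real" where
  "path_edge p x i j =
    of_bool ((j = Suc i \<and> i < length p \<and> p ! i = x) \<or> (i = Suc j \<and> j < length p \<and> p ! j = x))"

fun path_walks :: "letter list \<Rightarrow> letter list \<Rightarrow> nat \<Rightarrow> nat \<Rightarrow> real" where
  "path_walks p [] i j = of_bool (i = j)"
| "path_walks p (x # w) i j = (\<Sum>k\<le>length p. path_edge p x i k * path_walks p w k j)"

lemma path_edge_sym: "path_edge p x i j = path_edge p x j i"
  by (auto simp: path_edge_def)

lemma path_walks_append:
  assumes "i \<le> length p"
  shows "path_walks p (u @ v) i j = (\<Sum>k\<le>length p. path_walks p u i k * path_walks p v k j)"
  using assms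
proof (induction u arbitrary: i)
  case Nil
  then show ?case by (simp add: of_bool_def if_distrib[of "\<lambda>c. c * _"] cong: if_cong)
next
  case (Cons x u)
  have "path_walks p ((x # u) @ v) i j =
      (\<Sum>l\<le>length p. \<Sum>k\<le>length p. path_edge p x i l * (path_walks p u l k * path_walks p v k j))"
    by (simp add: Cons.IH sum_distrib_left)
  also have "\<dots> = (\<Sum>k\<le>length p. path_walks p (x # u) i k * path_walks p v k j)"
    by (subst sum.swap) (simp add: sum_distrib_right mult.assoc)
  finally show ?case .
qed

lemma path_walks_rev:
  assumes "i \<le> length p" "j \<le> length p"
  shows "path_walks p (rev w) i j = path_walks p w j i"
  using assms
proof (induction w arbitrary: i j)
  case Nil
  then show ?case by auto
next
  case (Cons x w)
  have single: "path_walks p [x] k j = path_edge p x j k" for k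
    using Cons.prems by (simp add: path_edge_sym[of p x k j] of_bool_def if_distrib cong: if_cong)
  have "path_walks p (rev (x # w)) i j
      = (\<Sum>k\<le>length p. path_walks p (rev w) i k * path_walks p [x] k j)"
    using Cons.prems by (simp only: rev.simps path_walks_append)
  also have "\<dots> = (\<Sum>k\<le>length p. path_edge p x j k * path_walks p w k i)"
    by (rule sum.cong) (use Cons in \<open>simp_all only: single atMost_iff mult.commute\<close>)
  finally show ?case by simp
qed

definition path_trace :: "letter list \<Rightarrow> letter list \<Rightarrow> real" where
  "path_trace p w = (\<Sum>i\<le>length p. path_walks p w i i)"

lemma path_trace_append:
  "path_trace p (u @ v) =
    (\<Sum>i\<le>length p. \<Sum>k\<le>length p. path_walks p u i k * path_walks p v k i)"
  by (simp add: path_trace_def path_walks_append)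

lemma tracial_path_trace: "tracial (path_trace p)"
  unfolding tracial_def path_trace_append
  by (subst sum.swap) (simp add: mult.commute)

lemma path_trace_rev_append:
  "path_trace p (rev u @ v) =
    (\<Sum>i\<le>length p. \<Sum>k\<le>length p. path_walks p u k i * path_walks p v k i)"
  by (simp add: path_trace_append path_walks_rev)

lemma path_walks_short:
  assumes "length w + i < length p"
  shows "path_walks p w i (length p) = 0"
  using assms
proof (induction w arbitrary: i)
  case (Cons x w)
  have "path_edge p x i k * path_walks p w k (length p) = 0" for k
    using Cons.IH[of k] Cons.prems by (cases "k \<le> Suc i") (auto simp: path_edge_def)
  then show ?case unfolding path_walks.simps by (intro sum.neutral) blast
qed auto

lemma path_walks_exact:
  assumes "length w + i = length p"
  shows "path_walks p w i (length p) = of_bool (w = drop i p)"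
  using assms
proof (induction w arbitrary: i)
  case (Cons x w)
  have i: "i < length p" "Suc i \<le> length p"
    using Cons.prems by auto
  have "path_edge p x i k * path_walks p w k (length p) = 0" if "k \<noteq> Suc i" for k
    using path_walks_short[of w k p] Cons.prems that by (auto simp: path_edge_def)
  then have "path_walks p (x # w) i (length p)
      = (\<Sum>k\<in>{Suc i}. path_edge p x i k * path_walks p w k (length p))"
    unfolding path_walks.simps by (intro sum.mono_neutral_right) (use i in auto)
  also have "\<dots> = of_bool (p ! i = x) * of_bool (w = drop (Suc i) p)"
    using Cons.IH[of "Suc i"] Cons.prems i by (simp add: path_edge_def)
  also have "\<dots> = of_bool (x # w = drop i p)"
    by (auto simp flip: Cons_nth_drop_Suc[OF i(1)])
  finally show ?case .
qed auto

text \<open>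
  A walk from one end of the path to the other has at least \<open>length p\<close> steps, and one with exactly
  that many never turns back, so it reads \<open>p\<close>. This corner entry therefore picks out the coefficient
  of \<open>p\<close> in any polynomial without longer words.
\<close>

lemma path_walks_0_length:
  assumes "length w \<le> length p"
  shows "path_walks p w 0 (length p) = of_bool (w = p)"
  using path_walks_short[of w 0 p] path_walks_exact[of w 0 p] assms
  by (cases "length w = length p") auto

section \<open>Bounding the number of letters in the squared polynomials\<close>

text \<open>
  Rotations preserve letter counts, so cutting a trace down to the words with a given number of
  letters \<open>x\<close> leaves a trace.
\<close>

definition graded_trace :: "letter \<Rightarrow> nat \<Rightarrow> letter list \<Rightarrow> letter list \<Rightarrow> real" where
  "graded_trace x m p w = of_bool (count_list w x = 2 * m) * path_trace p w"

lemma tracial_graded_trace: "tracial (graded_trace x m p)"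
  using tracial_path_trace[of p] by (auto simp: tracial_def graded_trace_def add.commute)

text \<open>
  Only the part of \<open>g\<close> of top degree \<open>m\<close> in \<open>x\<close> contributes, and the trace of the square of the
  matrix \<open>h\<close> that it gives is the sum of the squares of all entries of \<open>h\<close>. The corner entry is the
  coefficient of \<open>p\<close>.
\<close>

lemma graded_trace_hermitian_square_ge:
  assumes count: "\<And>w. w \<in> Poly_Mapping.keys g \<Longrightarrow> count_list w x \<le> m"
    and len: "\<And>w. w \<in> Poly_Mapping.keys g \<Longrightarrow> count_list w x = m \<Longrightarrow> length w \<le> length p"
    and p: "count_list p x = m"
  shows "(Poly_Mapping.lookup g p)\<^sup>2 \<le> nc_eval (graded_trace x m p) (nc_star g * g)"
proof -
  define K where "K = Poly_Mapping.keys g"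
  define c where "c w = of_bool (count_list w x = m) * Poly_Mapping.lookup g w" for w
  define h where "h k i = (\<Sum>w\<in>K. c w * path_walks p w k i)" for k i
  have [simp]: "finite K"
    by (simp add: K_def)
  \<comment> \<open>Two counts that are at most \<open>m\<close> have sum \<open>2 * m\<close> only if both are equal to \<open>m\<close>.\<close>
  have eq: "Poly_Mapping.lookup g u * Poly_Mapping.lookup g v * graded_trace x m p (rev u @ v)
      = c u * c v * path_trace p (rev u @ v)" if "u \<in> K" "v \<in> K" for u v
    using count[of u] count[of v] that by (auto simp: c_def graded_trace_def K_def count_list_rev)
  have "nc_eval (graded_trace x m p) (nc_star g * g)
      = (\<Sum>u\<in>K. \<Sum>v\<in>K. c u * c v * path_trace p (rev u @ v))"
    by (subst nc_eval_hermitian_square[of K]) (auto simp: K_def[symmetric] eq)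
  also have "\<dots> = (\<Sum>u\<in>K. \<Sum>v\<in>K. \<Sum>i\<le>length p. \<Sum>k\<le>length p.
      (c u * path_walks p u k i) * (c v * path_walks p v k i))"
    by (simp add: path_trace_rev_append sum_distrib_left mult_ac)
  also have "\<dots> = (\<Sum>u\<in>K. \<Sum>i\<le>length p. \<Sum>v\<in>K. \<Sum>k\<le>length p.
      (c u * path_walks p u k i) * (c v * path_walks p v k i))"
    by (intro sum.cong refl sum.swap)
  also have "\<dots> = (\<Sum>i\<le>length p. \<Sum>u\<in>K. \<Sum>k\<le>length p. \<Sum>v\<in>K.
      (c u * path_walks p u k i) * (c v * path_walks p v k i))"
    by (subst sum.swap) (intro sum.cong refl sum.swap)
  also have "\<dots> = (\<Sum>i\<le>length p. \<Sum>k\<le>length p. \<Sum>u\<in>K. \<Sum>v\<in>K.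
      (c u * path_walks p u k i) * (c v * path_walks p v k i))"
    by (intro sum.cong refl sum.swap)
  also have "\<dots> = (\<Sum>i\<le>length p. \<Sum>k\<le>length p. (h k i)\<^sup>2)"
    by (simp add: h_def power2_eq_square sum_product)
  finally have squares: "nc_eval (graded_trace x m p) (nc_star g * g)
      = (\<Sum>i\<le>length p. \<Sum>k\<le>length p. (h k i)\<^sup>2)" .
  have "c w * path_walks p w 0 (length p) = of_bool (w = p) * Poly_Mapping.lookup g p"
    if "w \<in> K" for w
    using len[of w] that p
    by (cases "count_list w x = m") (auto simp: c_def K_def path_walks_0_length)
  then have "h 0 (length p) = (\<Sum>w\<in>K. of_bool (w = p) * Poly_Mapping.lookup g p)"
    unfolding h_def by (intro sum.cong) auto
  also have "\<dots> = Poly_Mapping.lookup g p"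
    by (auto simp: of_bool_def if_distrib[of "\<lambda>c. c * _"] K_def in_keys_iff cong: if_cong)
  finally have "(Poly_Mapping.lookup g p)\<^sup>2 = (h 0 (length p))\<^sup>2"
    by simp
  also have "\<dots> \<le> (\<Sum>k\<le>length p. (h k (length p))\<^sup>2)"
    by (rule member_le_sum) auto
  also have "\<dots> \<le> (\<Sum>i\<le>length p. \<Sum>k\<le>length p. (h k i)\<^sup>2)"
    by (rule member_le_sum[of "length p" _ "\<lambda>i. \<Sum>k\<le>length p. (h k i)\<^sup>2"])
      (auto intro: sum_nonneg)
  finally show ?thesis
    using squares by simp
qed

text \<open>
  Hermitian squares cannot cancel in their top degree: the trace attached to a word \<open>p\<close> of maximal
  count, and of maximal length among those, is positive at their sum, so \<open>f\<close> too has a word with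
  twice that count.
\<close>

lemma count_le_of_cyclically_equivalent_squares:
  assumes equiv: "cyclically_equivalent f (\<Sum>g\<leftarrow>gs. nc_star g * g)"
    and f: "\<And>w. w \<in> Poly_Mapping.keys f \<Longrightarrow> count_list w x \<le> 2 * k"
    and g: "g \<in> set gs" "w \<in> Poly_Mapping.keys g"
  shows "count_list w x \<le> k"
proof -
  define U where "U = (\<Union>g\<in>set gs. Poly_Mapping.keys g)"
  define m where "m = Max ((\<lambda>w. count_list w x) ` U)"
  define V where "V = {w \<in> U. count_list w x = m}"
  have U: "finite U" "w \<in> U"
    using g by (auto simp: U_def)
  have le_m: "count_list u x \<le> m" if "u \<in> U" for u
    unfolding m_def using U that by (intro Max_ge) auto
  have "m \<in> (\<lambda>w. count_list w x) ` U"
    unfolding m_def using U by (intro Max_in) auto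
  then have V: "finite V" "V \<noteq> {}"
    using U by (auto simp: V_def)
  then have "Max (length ` V) \<in> length ` V"
    by (intro Max_in) auto
  then obtain p where p: "p \<in> V" "length p = Max (length ` V)"
    by auto
  then have p_longest: "length u \<le> length p" if "u \<in> V" for u
    using V(1) that by simp
  define \<phi> where "\<phi> = graded_trace x m p"
  have sq: "(Poly_Mapping.lookup g p)\<^sup>2 \<le> nc_eval \<phi> (nc_star g * g)" if "g \<in> set gs" for g
    unfolding \<phi>_def using p(1) p_longest le_m that
    by (intro graded_trace_hermitian_square_ge) (auto simp: V_def U_def)
  obtain g' where g': "g' \<in> set gs" "p \<in> Poly_Mapping.keys g'"
    using p(1) by (auto simp: V_def U_def)
  have "0 < (Poly_Mapping.lookup g' p)\<^sup>2"
    using g'(2) by (simp add: in_keys_iff)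
  also have "\<dots> \<le> nc_eval \<phi> (nc_star g' * g')"
    using sq g'(1) .
  also have "\<dots> \<le> (\<Sum>g\<leftarrow>gs. nc_eval \<phi> (nc_star g * g))"
    using g'(1) order_trans[OF zero_le_power2 sq]
    by (intro member_le_sum_list) auto
  also have "\<dots> = nc_eval \<phi> f"
    using nc_eval_cyclically_equivalent[OF tracial_graded_trace equiv]
    by (simp add: \<phi>_def nc_eval_sum_list)
  finally have "nc_eval \<phi> f \<noteq> 0"
    by simp
  then obtain u where "u \<in> Poly_Mapping.keys f" "\<phi> u \<noteq> 0"
    unfolding nc_eval_def by (metis (no_types, lifting) mult_zero_right sum.neutral)
  then have "m \<le> k"
    using f[of u] by (auto simp: \<phi>_def graded_trace_def)
  then show ?thesis
    using le_m[OF U(2)] by simp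
qed

section \<open>The separating trace\<close>

definition rotation_sum :: "(letter list \<Rightarrow> real) \<Rightarrow> letter list \<Rightarrow> real" where
  "rotation_sum \<psi> w = (\<Sum>n<length w. \<psi> (rotate n w))"

lemma rotation_sum_rotate1: "rotation_sum \<psi> (rotate1 w) = rotation_sum \<psi> w"
proof -
  have "rotation_sum \<psi> (rotate1 w) + \<psi> w = (\<Sum>n<Suc (length w). \<psi> (rotate n w))"
    unfolding sum.lessThan_Suc_shift by (simp add: rotation_sum_def rotate1_rotate_swap)
  also have "\<dots> = rotation_sum \<psi> w + \<psi> w"
    by (simp add: rotation_sum_def)
  finally show ?thesis by simp
qed

lemma tracial_rotation_sum: "tracial (rotation_sum \<psi>)"
proof -
  have "rotation_sum \<psi> (rotate n w) = rotation_sum \<psi> w" for n w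
    by (induction n) (simp_all add: rotation_sum_rotate1)
  then show ?thesis
    unfolding tracial_def by (metis rotate_append)
qed

lemma count_list_rotate: "count_list (rotate n w) x = count_list w x"
proof -
  have "count_list (rotate1 w) x = count_list w x" for w
    by (cases w) simp_all
  then show ?thesis
    by (induction n) simp_all
qed

text \<open>
  Rotations permute the words of \<open>nc_S m k\<close>, so the value of a rotation sum at \<open>nc_S m k\<close> can be read
  off from \<open>\<psi>\<close>.
\<close>

lemma sum_rotation_sum:
  "(\<Sum>w | length w = m \<and> count_list w B = k. rotation_sum \<psi> w)
    = m * (\<Sum>w | length w = m \<and> count_list w B = k. \<psi> w)"
proof -
  let ?S = "{w :: letter list. length w = m \<and> count_list w B = k}"
  have "(\<Sum>w\<in>?S. \<psi> (rotate n w)) = (\<Sum>w\<in>?S. \<psi> w)" for n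
  proof -
    have inj: "inj_on (rotate n) ?S"
      unfolding rotate_def by (intro inj_on_subset[OF inj_fn] inj_rotate1) simp
    have "rotate n ` ?S = ?S"
      by (rule card_subset_eq[OF finite_nc_S_index])
        (auto simp: count_list_rotate card_image[OF inj])
    then show ?thesis
      using sum.reindex[OF inj, of \<psi>] by simp
  qed
  moreover have "(\<Sum>w\<in>?S. rotation_sum \<psi> w) = (\<Sum>n<m. \<Sum>w\<in>?S. \<psi> (rotate n w))"
    by (subst sum.swap) (simp add: rotation_sum_def)
  ultimately show ?thesis by simp
qed

text \<open>
  One word is chosen from each of seven cyclic classes; the other three classes of words with four
  letters of each kind get the value 0. The rotation sum takes the value of \<open>weight\<close> on the whole
  class, except that \<open>AABBAABB\<close> is fixed by rotation by four places: its weight 3 is counted twice,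
  and the value there is 6. The resulting trace is invariant under reversal, which swaps the classes
  of the fourth and the fifth word, and under exchange of the two letters, which swaps those of the
  sixth and the seventh. As \<open>nc_S 8 4\<close> has both symmetries, nothing is lost by averaging over them.
  The values are a small integer point in the set of traces whose Gram matrix on the six words with
  two letters of each kind is positive semidefinite, in the region where the weights have negative
  sum.
\<close>

definition weight :: "letter list \<Rightarrow> real" where
  "weight w =
      10 * of_bool (w = [A,A,A,A,B,B,B,B])
    + 3 * of_bool (w = [A,A,B,B,A,A,B,B])
    + 6 * of_bool (w = [A,A,B,A,B,B,A,B])
    - 4 * of_bool (w = [A,A,A,B,A,B,B,B])
    - 4 * of_bool (w = [A,A,A,B,B,B,A,B])
    - 6 * of_bool (w = [A,A,A,B,B,A,B,B])
    - 6 * of_bool (w = [A,A,B,A,A,B,B,B])"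

lemma rotation_sum_length_8:
  assumes "length w = 8"
  shows "rotation_sum \<psi> w = \<psi> w + \<psi> (rotate 1 w) + \<psi> (rotate 2 w) + \<psi> (rotate 3 w)
    + \<psi> (rotate 4 w) + \<psi> (rotate 5 w) + \<psi> (rotate 6 w) + \<psi> (rotate 7 w)"
  by (simp add: rotation_sum_def assms lessThan_nat_numeral lessThan_Suc add_ac)

lemma weight_nonzero: "weight w \<noteq> 0 \<Longrightarrow> count_list w A = 4 \<and> count_list w B = 4"
  by (auto simp: weight_def of_bool_def split: if_splits)

lemma rotation_sum_weight_nonzero:
  assumes "rotation_sum weight w \<noteq> 0"
  shows "count_list w A = 4 \<and> count_list w B = 4"
proof -
  obtain n where "weight (rotate n w) \<noteq> 0"
    using assms unfolding rotation_sum_def by (meson sum.neutral)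
  then show ?thesis
    using weight_nonzero[of "rotate n w"] by (simp add: count_list_rotate)
qed

lemma nc_eval_nc_S: "nc_eval \<phi> (nc_S m k) = (\<Sum>w | length w = m \<and> count_list w B = k. \<phi> w)"
  by (simp add: nc_S_def nc_eval_sum nc_word_eq_single nc_eval_single)

lemma keys_nc_S:
  assumes "w \<in> Poly_Mapping.keys (nc_S m k)"
  shows "length w = m \<and> count_list w B = k"
  using assms Poly_Mapping.keys_sum[of nc_word "{w. length w = m \<and> count_list w B = k}"]
  by (auto simp: nc_S_def nc_word_eq_single)

lemma count_list_A_plus_B: "count_list w A + count_list w B = length w"
proof (induction w)
  case (Cons x w)
  then show ?case by (cases x) auto
qed simp

lemma rotation_sum_weight_nc_S: "nc_eval (rotation_sum weight) (nc_S 8 4) = -8"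
proof -
  have "(\<Sum>w | length w = 8 \<and> count_list w B = 4. c * of_bool (w = r)) = c"
    if "length r = 8" "count_list r B = 4" for c :: real and r
    using that finite_nc_S_index[of 8 4]
    by (simp add: of_bool_def if_distrib[of "\<lambda>x. c * x"] cong: if_cong)
  then have "(\<Sum>w | length w = 8 \<and> count_list w B = 4. weight w) = -1"
    by (simp add: weight_def sum.distrib sum_subtractf)
  then show ?thesis
    by (simp add: nc_eval_nc_S sum_rotation_sum)
qed

definition balanced_words :: "letter list set" where
  "balanced_words = {w. count_list w A = 2 \<and> count_list w B = 2}"

lemma balanced_words_eq:
  "balanced_words = {[A,A,B,B], [B,B,A,A], [A,B,A,B], [B,A,B,A], [A,B,B,A], [B,A,A,B]}"
proof (intro equalityI subsetI)
  fix w
  assume w: "w \<in> balanced_words"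
  then have "length w = 4"
    using count_list_A_plus_B[of w] by (simp add: balanced_words_def)
  then obtain a b c d where "w = [a, b, c, d]"
    by (auto simp: length_Suc_conv numeral_eq_Suc)
  then show "w \<in> {[A,A,B,B], [B,B,A,A], [A,B,A,B], [B,A,B,A], [A,B,B,A], [B,A,A,B]}"
    using w by (cases a; cases b; cases c; cases d) (auto simp: balanced_words_def)
qed (auto simp: balanced_words_def)

text \<open>
  The intermediate equations are the rows of the Gram matrix of the trace. The last two rows are
  equal and vanish on \<open>ABAB\<close> and \<open>BABA\<close>; completing the square in \<open>y [A,B,B,A] + y [B,A,A,B]\<close> leaves
  two separate positive definite forms, in the coefficients of \<open>AABB, ABAB\<close> and of \<open>BBAA, BABA\<close>.
\<close>

lemma rotation_sum_weight_quadratic_form: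
  fixes y :: "letter list \<Rightarrow> real"
  shows "(\<Sum>u\<in>balanced_words. \<Sum>v\<in>balanced_words.
      y u * y v * rotation_sum weight (rev u @ v)) =
      6 * (y [A,B,B,A] + y [B,A,A,B] - y [A,A,B,B] - y [B,B,A,A])\<^sup>2
    + 4 * (y [A,A,B,B] - y [A,B,A,B])\<^sup>2 + 4 * (y [B,B,A,A] - y [B,A,B,A])\<^sup>2
    + 2 * (y [A,B,A,B])\<^sup>2 + 2 * (y [B,A,B,A])\<^sup>2"
proof -
  define row where "row u = (\<Sum>v\<in>balanced_words. y v * rotation_sum weight (rev u @ v))" for u
  note compute = row_def balanced_words_eq rotation_sum_length_8 rotate_drop_take weight_def
  have "row [A,A,B,B] = 10 * y [A,A,B,B] + 6 * y [B,B,A,A] - 4 * y [A,B,A,B] - 6 * y [A,B,B,A] - 6 * y [B,A,A,B]"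
    by (simp add: compute)
  moreover have "row [B,B,A,A] = 6 * y [A,A,B,B] + 10 * y [B,B,A,A] - 4 * y [B,A,B,A] - 6 * y [A,B,B,A] - 6 * y [B,A,A,B]"
    by (simp add: compute)
  moreover have "row [A,B,A,B] = - 4 * y [A,A,B,B] + 6 * y [A,B,A,B]"
    by (simp add: compute)
  moreover have "row [B,A,B,A] = - 4 * y [B,B,A,A] + 6 * y [B,A,B,A]"
    by (simp add: compute)
  moreover have "row [A,B,B,A] = - 6 * y [A,A,B,B] - 6 * y [B,B,A,A] + 6 * y [A,B,B,A] + 6 * y [B,A,A,B]"
    by (simp add: compute)
  moreover have "row [B,A,A,B] = - 6 * y [A,A,B,B] - 6 * y [B,B,A,A] + 6 * y [A,B,B,A] + 6 * y [B,A,A,B]"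
    by (simp add: compute)
  ultimately have "(\<Sum>u\<in>balanced_words. y u * row u) =
      6 * (y [A,B,B,A] + y [B,A,A,B] - y [A,A,B,B] - y [B,B,A,A])\<^sup>2
    + 4 * (y [A,A,B,B] - y [A,B,A,B])\<^sup>2 + 4 * (y [B,B,A,A] - y [B,A,B,A])\<^sup>2
    + 2 * (y [A,B,A,B])\<^sup>2 + 2 * (y [B,A,B,A])\<^sup>2"
    by (simp add: balanced_words_eq) (simp add: power2_eq_square algebra_simps)
  then show ?thesis
    by (simp only: row_def sum_distrib_left mult.assoc)
qed

lemma rotation_sum_weight_hermitian_square_nonneg:
  assumes count: "\<And>w x. w \<in> Poly_Mapping.keys g \<Longrightarrow> count_list w x \<le> 2"
  shows "0 \<le> nc_eval (rotation_sum weight) (nc_star g * g)"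
proof -
  define W where "W = balanced_words"
  define K where "K = Poly_Mapping.keys g \<union> W"
  define q where "q u v = Poly_Mapping.lookup g u * Poly_Mapping.lookup g v
    * rotation_sum weight (rev u @ v)" for u v
  have K: "finite K" "Poly_Mapping.keys g \<subseteq> K" "W \<subseteq> K"
    by (auto simp: K_def W_def balanced_words_eq)
  \<comment> \<open>The trace sees only words with four letters of each kind, which have to be split evenly.\<close>
  have outside: "u \<in> W \<and> v \<in> W" if "q u v \<noteq> 0" for u v
  proof -
    have uv: "count_list u x \<le> 2" "count_list v x \<le> 2" for x
      using that count by (auto simp: q_def in_keys_iff)
    have sums: "count_list u A + count_list v A = 4" "count_list u B + count_list v B = 4"
      using that rotation_sum_weight_nonzero[of "rev u @ v"]
      by (auto simp: q_def count_list_rev)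
    show ?thesis
      using sums uv[of A] uv[of B] by (auto simp: W_def balanced_words_def)
  qed
  have "nc_eval (rotation_sum weight) (nc_star g * g) = (\<Sum>u\<in>K. \<Sum>v\<in>K. q u v)"
    by (simp add: nc_eval_hermitian_square[OF K(1,2)] q_def)
  also have "\<dots> = (\<Sum>u\<in>W. \<Sum>v\<in>K. q u v)"
    using K outside by (intro sum.mono_neutral_right) (auto intro!: sum.neutral)
  also have "\<dots> = (\<Sum>u\<in>W. \<Sum>v\<in>W. q u v)"
    using K outside by (intro sum.cong refl sum.mono_neutral_right) auto
  finally show ?thesis
    by (simp add: q_def W_def rotation_sum_weight_quadratic_form)
qed

theorem proposition3p8:
  shows "\<not> (\<exists>g. sum_of_hermitian_squares g \<and> cyclically_equivalent (nc_S 8 4) g)"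
proof
  assume "\<exists>g. sum_of_hermitian_squares g \<and> cyclically_equivalent (nc_S 8 4) g"
  then obtain gs where equiv: "cyclically_equivalent (nc_S 8 4) (\<Sum>g\<leftarrow>gs. nc_star g * g)"
    by (auto simp: sum_of_hermitian_squares_def)
  have "count_list w x \<le> 2 * 2" if "w \<in> Poly_Mapping.keys (nc_S 8 4)" for w x
    using keys_nc_S[OF that] count_list_A_plus_B[of w] by (cases x) auto
  from count_le_of_cyclically_equivalent_squares[OF equiv this]
  have "0 \<le> nc_eval (rotation_sum weight) (nc_star g * g)" if "g \<in> set gs" for g
    using that by (intro rotation_sum_weight_hermitian_square_nonneg)
  then have "0 \<le> nc_eval (rotation_sum weight) (\<Sum>g\<leftarrow>gs. nc_star g * g)"
    by (auto simp: nc_eval_sum_list intro!: sum_list_nonneg)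
  also have "\<dots> = -8"
    using nc_eval_cyclically_equivalent[OF tracial_rotation_sum equiv]
      rotation_sum_weight_nc_S by simp
  finally show False by simp
qed

end
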